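(* Consider a one-buyer FPPE with $b_1=1$ and $\mathbb E[v_1]=\int v_1s\,d\theta=1$. Let $\beta^*=\operatorname{argmin}_{\beta\in(0,1]}\{\beta\,\mathbb E[v_1]-b_1\log\beta\}$ and $\beta^\gamma=\operatorname{argmin}_{\beta\in(0,1]}\{\beta\,\frac1t\sum_{\tau=1}^tv_1(\theta^\tau)-b_1\log\beta\}$. Given $\theta^1,\dots,\theta^t$, let $\theta^{1,\mathrm{boot}},\dots,\theta^{t,\mathrm{boot}}$ be resampled with replacement from $\{\theta^1,\dots,\theta^t\}$ (standard multinomial bootstrap), and let $$\beta^{\mathrm{boot}}=\operatorname*{argmin}_{\beta\in(0,1]}\ \frac1t\sum_{\tau=1}^t\beta\,v_1(\theta^{\tau,\mathrm{boot}})-b_1\log\beta .$$ Then the limit conditional distribution (given the data) of $\sqrt t(\beta^{\mathrm{boot}}-\beta^\gamma)$ is not equal to the limit distribution of $\sqrt t(\beta^\gamma-\beta^* )$; that is, if $L$ denotes the limit law of $\sqrt t(\beta^\gamma-\beta^* )$, then the conditional distribution of $\sqrt t(\beta^{\mathrm{boot}}-\beta^\gamma)$ does not consistently estimate $L$.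
   Context: $\Theta$ is a measurable item space with integrating measure $d\theta$; $s\ge0$ is a bounded supply function with $\int_\Theta s\,d\theta=1$; the valuation $v_1:\Theta\to[0,\infty)$ is bounded and integrable; $\mathbb E[g]=\int g\,s\,d\theta$. $\theta^1,\theta^2,\dots$ are i.i.d. draws from the density $s$. $\beta^*$ and $\beta^\gamma$ are the pacing multipliers of the limit and of the finite (observed) first-price pacing equilibrium (FPPE) with one buyer of budget $b_1$. Consistency: for random variables $X_t$ that are functions of the data $(\theta^\tau)_{\tau\le t}$ and of bootstrap randomness independent of the data, the conditional distribution of $X_t$ consistently estimates a law $L$ if $$\sup_{f\in\mathrm{BL}_1}\big|\mathbb E[f(X_t)\mid\theta^1,\dots,\theta^t]-\mathbb E_{X\sim L}[f(X)]\big|\to0\text{ in probability},$$ where $\mathrm{BL}_1$ is the set of $f:\mathbb R\to\mathbb R$ with $\sup|f|\le1$ and $|f(x)-f(y)|\le|x-y|$.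
   Formalization: The formal theorem also assumes that v_1 has positive variance under s; if v_1 = 1 s-almost everywhere, all multipliers equal 1, both laws are the point mass at 0, and the bootstrap is consistent, so the claim fails there. *)

theory Defs
  imports "HOL-Probability.Probability"
begin

definition supply_mean :: "'a measure \<Rightarrow> ('a \<Rightarrow> real) \<Rightarrow> ('a \<Rightarrow> real) \<Rightarrow> real" where
  "supply_mean \<Theta> s g = (\<integral>x. g x * s x \<partial>\<Theta>)"

text \<open>
  The one-buyer dual program: \<open>b\<close> is the budget and \<open>m\<close> the mean valuation (over the supply, the
  sample or the resample).  For \<open>b > 0\<close> and \<open>m \<ge> 0\<close> the objective is strictly convex with a
  minimum attained on \<open>(0,1]\<close>, so the choice made by \<^const>\<open>arg_min_on\<close> is the unique minimiser.
\<close>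

definition pacing_multiplier :: "real \<Rightarrow> real \<Rightarrow> real" where
  "pacing_multiplier b m = arg_min_on (\<lambda>\<beta>. \<beta> * m - b * ln \<beta>) {0<..1}"

definition sample_mean :: "(nat \<Rightarrow> real) \<Rightarrow> nat \<Rightarrow> real" where
  "sample_mean x t = (\<Sum>\<tau>=1..t. x \<tau>) / real t"

definition sample_vec :: "(nat \<Rightarrow> 'w \<Rightarrow> 'b) \<Rightarrow> nat \<Rightarrow> 'w \<Rightarrow> nat \<Rightarrow> 'b" where
  "sample_vec Z t \<omega> = (\<lambda>\<tau>\<in>{1..t}. Z \<tau> \<omega>)"

definition data_algebra :: "'w measure \<Rightarrow> 'b measure \<Rightarrow> (nat \<Rightarrow> 'w \<Rightarrow> 'b) \<Rightarrow> nat \<Rightarrow> 'w measure" where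
  "data_algebra M N Z t = vimage_algebra (space M) (sample_vec Z t) (\<Pi>\<^sub>M \<tau>\<in>{1..t}. N)"

definition iid_draws :: "'w measure \<Rightarrow> 'a measure \<Rightarrow> ('a \<Rightarrow> real) \<Rightarrow> (nat \<Rightarrow> 'w \<Rightarrow> 'a) \<Rightarrow> bool" where
  "iid_draws M \<Theta> s \<theta> \<longleftrightarrow>
     prob_space.indep_vars M (\<lambda>_. \<Theta>) \<theta> {1..} \<and>
     (\<forall>\<tau>\<ge>1. distributed M \<Theta> (\<theta> \<tau>) (\<lambda>x. ennreal (s x)))"

text \<open>
  \<open>J t \<tau>\<close> is the position in the sample \<open>\<theta> 1, \<dots>, \<theta> t\<close> of the \<open>\<tau>\<close>-th resampled item.  Drawing
  positions rather than values makes items that occur repeatedly in the sample count repeatedly.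
\<close>

definition multinomial_bootstrap ::
    "'w measure \<Rightarrow> 'a measure \<Rightarrow> (nat \<Rightarrow> 'w \<Rightarrow> 'a) \<Rightarrow> (nat \<Rightarrow> nat \<Rightarrow> 'w \<Rightarrow> nat) \<Rightarrow> bool" where
  "multinomial_bootstrap M \<Theta> \<theta> J \<longleftrightarrow> (\<forall>t\<ge>1.
     prob_space.indep_vars M (\<lambda>_. count_space {1..t}) (J t) {1..t} \<and>
     (\<forall>\<tau>\<in>{1..t}. distr M (count_space {1..t}) (J t \<tau>) = uniform_count_measure {1..t}) \<and>
     prob_space.indep_set M (sets (data_algebra M \<Theta> \<theta> t))
       (sets (data_algebra M (count_space {1..t}) (J t) t)))"

definition resample :: "(nat \<Rightarrow> 'w \<Rightarrow> 'a) \<Rightarrow> (nat \<Rightarrow> nat \<Rightarrow> 'w \<Rightarrow> nat) \<Rightarrow> nat \<Rightarrow> nat \<Rightarrow> 'w \<Rightarrow> 'a" where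
  "resample \<theta> J t \<tau> \<omega> = \<theta> (J t \<tau> \<omega>) \<omega>"

definition BL1 :: "(real \<Rightarrow> real) set" where
  "BL1 = {f. (\<forall>x. \<bar>f x\<bar> \<le> 1) \<and> (\<forall>x y. \<bar>f x - f y\<bar> \<le> \<bar>x - y\<bar>)}"

text \<open>
  \<open>K\<close> is a regular conditional distribution of \<open>X\<close> given the sub-\<open>\<sigma>\<close>-algebra \<open>F\<close>.  For real-valued
  random variables it exists and is unique almost surely.  It is needed because a conditional
  expectation is determined only almost everywhere for each single \<open>f\<close>, whereas consistency takes a
  supremum over uncountably many \<open>f\<close>.
\<close>

definition cond_distribution ::
    "'w measure \<Rightarrow> 'w measure \<Rightarrow> ('w \<Rightarrow> real) \<Rightarrow> ('w \<Rightarrow> real measure) \<Rightarrow> bool" where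
  "cond_distribution M F X K \<longleftrightarrow>
     K \<in> F \<rightarrow>\<^sub>M prob_algebra borel \<and>
     (\<forall>f\<in>borel_measurable borel. bounded (range f) \<longrightarrow>
        (AE \<omega> in M. real_cond_exp M F (\<lambda>\<omega>. f (X \<omega>)) \<omega> = (\<integral>x. f x \<partial>K \<omega>)))"

text \<open>
  The outer measure equals \<open>M\<close> itself on measurable sets, so this is convergence to 0 in
  probability for random variables.
\<close>

definition tends_to_0_in_prob :: "'w measure \<Rightarrow> (nat \<Rightarrow> 'w \<Rightarrow> real) \<Rightarrow> bool" where
  "tends_to_0_in_prob M Y \<longleftrightarrow>
     (\<forall>\<epsilon>>0. (\<lambda>t. outer_measure_of M {\<omega>\<in>space M. \<bar>Y t \<omega>\<bar> > \<epsilon>}) \<longlonglongrightarrow> 0)"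

definition consistently_estimates ::
    "'w measure \<Rightarrow> (nat \<Rightarrow> 'w measure) \<Rightarrow> (nat \<Rightarrow> 'w \<Rightarrow> real) \<Rightarrow> real measure \<Rightarrow> bool" where
  "consistently_estimates M F X L \<longleftrightarrow>
     (\<exists>K. (\<forall>t. cond_distribution M (F t) (X t) (K t)) \<and>
          tends_to_0_in_prob M
            (\<lambda>t \<omega>. SUP f\<in>BL1. \<bar>(\<integral>x. f x \<partial>K t \<omega>) - (\<integral>x. f x \<partial>L)\<bar>))"

end

theory Submission
  imports Defs
begin

text \<open>
  With unit budget the pacing multiplier of a market with mean valuation \<open>m\<close> is \<open>1 / max 1 m\<close>
  (\<open>pacing_multiplier_one\<close>).  The limit market has \<open>m = 1\<close>, exactly at the kink, and this is why
  the bootstrap fails.  Write \<open>m\<^sub>t\<close> for the sample mean, \<open>m\<^sub>t\<^sup>b\<close> for the resampled mean and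
  \<open>\<sigma>\<^sup>2\<close> for the variance of a valuation.

  \<^item> By the central limit theorem \<open>\<surd>t (m\<^sub>t - 1)\<close> is asymptotically \<open>\<sigma> Z\<close> with \<open>Z\<close> standard
    normal, so \<open>\<surd>t (1 / max 1 m\<^sub>t - 1)\<close> converges in law to \<open>- max 0 (\<sigma> Z)\<close>.  This law charges
    \<open>{..<0}\<close>; hence the test function \<open>f x = max (-1) (min 0 x)\<close> has a negative integral \<open>-d\<close>.

  \<^item> Fix \<open>K > 0\<close> and look at the data event \<open>\<surd>t (1 - m\<^sub>t) \<ge> K\<close>, whose probability tends to a
    positive number \<open>p\<close>.  There \<open>m\<^sub>t\<close> lies on the flat side of the kink, and the bootstrap error
    is nonzero only if the resampled mean climbs back above \<open>1\<close>, that is, only if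
    \<open>\<surd>t (m\<^sub>t\<^sup>b - m\<^sub>t) > K\<close>.  Given the data, the variance of \<open>\<surd>t m\<^sub>t\<^sup>b\<close> is the sample variance,
    which is at most \<open>B\<^sup>2\<close> if \<open>B\<close> bounds the valuations.  By Chebyshev's inequality this has
    conditional probability at most \<open>B\<^sup>2 / K\<^sup>2\<close>, so on the event the bootstrap puts the mean of
    \<open>f\<close> at or above \<open>- B\<^sup>2 / K\<^sup>2\<close>.

  \<^item> A consistent bootstrap would give \<open>f\<close> a mean close to \<open>-d\<close> on every sequence of
    data events of nonvanishing probability (\<open>consistently_estimates_on_data_events\<close>).  For \<open>B\<^sup>2 / K\<^sup>2 = d / 2\<close> the two
    statements contradict each other.
\<close>

section \<open>The pacing multiplier in closed form\<close>

text \<open>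
  Strict minimality is needed, and not just a minimal value, because the arg-min operator picks an
  arbitrary minimiser.  It follows from the strict form of \<open>ln x \<le> x - 1\<close> at \<open>x = \<beta> / b\<close>, where
  \<open>b\<close> is the claimed minimiser.
\<close>

lemma pacing_multiplier_one:
  assumes "0 \<le> m"
  shows "pacing_multiplier 1 m = 1 / max 1 m"
proof -
  define \<phi> where "\<phi> = (\<lambda>\<beta>. \<beta> * m - ln \<beta>)"
  define b where "b = 1 / max 1 m"
  have b: "0 < b" "b \<le> 1"
    by (auto simp: b_def field_simps)
  have strict: "\<phi> b < \<phi> \<beta>" if "0 < \<beta>" "\<beta> \<le> 1" "\<beta> \<noteq> b" for \<beta>
  proof -
    have "ln (\<beta> / b) < \<beta> / b - 1"
      using ln_le_minus_one[of "\<beta> / b"] ln_eq_minus_one[of "\<beta> / b"] that b by fastforce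
    \<comment> \<open>first-order optimality: \<open>m - max 1 m\<close> is the slope at \<open>b\<close>, which is negative only at the
      right end of \<open>(0,1]\<close>\<close>
    moreover have "0 \<le> (\<beta> - b) * (m - max 1 m)"
    proof (cases "m \<le> 1")
      case True
      then have "b = 1" by (simp add: b_def)
      then show ?thesis using True that by (simp add: mult_nonpos_nonpos)
    qed simp
    moreover have "(\<beta> - b) * (m - max 1 m) = m * (\<beta> - b) - (\<beta> / b - 1)"
      by (simp add: b_def field_simps)
    moreover have "\<phi> \<beta> - \<phi> b = m * (\<beta> - b) - ln (\<beta> / b)"
      using that b by (simp add: \<phi>_def ln_div algebra_simps)
    ultimately show ?thesis by linarith
  qed
  have "pacing_multiplier 1 m = arg_min \<phi> (\<lambda>\<beta>. \<beta> \<in> {0<..1})"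
    by (simp add: pacing_multiplier_def arg_min_on_def \<phi>_def)
  also have "\<dots> = b"
  proof (rule arg_minI[where x = b])
    show "b \<in> {0<..1}" using b by simp
    show "\<not> \<phi> y < \<phi> b" if "y \<in> {0<..1}" for y
      using strict[of y] that by fastforce
    show "x = b" if "x \<in> {0<..1}" "\<forall>y. y \<in> {0<..1} \<longrightarrow> \<not> \<phi> y < \<phi> x" for x
      using strict[of x] that b by fastforce
  qed
  finally show ?thesis by (simp add: b_def)
qed

section \<open>The limit law of the rescaled multiplier\<close>

text \<open>
  The mapping theorem for maps that vary with \<open>n\<close>.  Skorohod's representation turns weak
  convergence into pointwise convergence of representing variables, to which the hypothesis on
  \<open>g\<close> and \<open>h\<close> applies directly.  It takes the place of the delta method, which is
  unavailable at a kink.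
\<close>

lemma weak_conv_m_extended_mapping:
  fixes g :: "nat \<Rightarrow> real \<Rightarrow> real" and h :: "real \<Rightarrow> real"
  assumes \<mu>: "\<And>n. real_distribution (\<mu> n)" and N: "real_distribution N"
    and conv: "weak_conv_m \<mu> N"
    and [measurable]: "\<And>n. g n \<in> borel_measurable borel" "h \<in> borel_measurable borel"
    and lim: "\<And>y x. y \<longlonglongrightarrow> x \<Longrightarrow> (\<lambda>n. g n (y n)) \<longlonglongrightarrow> h x"
  shows "weak_conv_m (\<lambda>n. distr (\<mu> n) borel (g n)) (distr N borel h)"
proof -
  obtain \<Omega> :: "real measure" and Y_seq Y where \<Omega>: "prob_space \<Omega>"
    and [measurable]: "\<And>n. Y_seq n \<in> borel_measurable \<Omega>"
    and Yd: "\<And>n. distr \<Omega> borel (Y_seq n) = \<mu> n"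
    and Y: "Y \<in> measurable \<Omega> lborel" and Yd': "distr \<Omega> borel Y = N"
    and pw: "\<And>x. x \<in> space \<Omega> \<Longrightarrow> (\<lambda>n. Y_seq n x) \<longlonglongrightarrow> Y x"
    using Skorohod[OF \<mu> N conv] by blast
  have [measurable]: "Y \<in> borel_measurable \<Omega>" using Y by simp
  interpret \<Omega>: prob_space \<Omega> by fact
  have eq: "distr (\<mu> n) borel (g n) = distr \<Omega> borel (\<lambda>x. g n (Y_seq n x))" for n
    unfolding Yd[symmetric] by (subst distr_distr) (auto simp: comp_def)
  have eq': "distr N borel h = distr \<Omega> borel (\<lambda>x. h (Y x))"
    unfolding Yd'[symmetric] by (subst distr_distr) (auto simp: comp_def)
  have rd: "real_distribution (distr \<Omega> borel (\<lambda>x. g n (Y_seq n x)))" for n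
    by (rule \<Omega>.real_distribution_distr) simp
  have rd': "real_distribution (distr \<Omega> borel (\<lambda>x. h (Y x)))"
    by (rule \<Omega>.real_distribution_distr) simp
  show ?thesis unfolding eq eq'
  proof (rule integral_bdd_continuous_conv_imp_weak_conv[OF rd rd'])
    fix f :: "real \<Rightarrow> real"
    assume cont: "\<And>x. isCont f x" and bd: "\<And>x. \<bar>f x\<bar> \<le> 1"
    have [measurable]: "f \<in> borel_measurable borel"
      using cont by (intro borel_measurable_continuous_onI continuous_at_imp_continuous_on) auto
    have "(\<lambda>n. \<integral>x. f (g n (Y_seq n x)) \<partial>\<Omega>) \<longlonglongrightarrow> (\<integral>x. f (h (Y x)) \<partial>\<Omega>)"
    proof (rule integral_dominated_convergence[where w = "\<lambda>_. 1"])
      show "AE x in \<Omega>. (\<lambda>n. f (g n (Y_seq n x))) \<longlonglongrightarrow> f (h (Y x))"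
        using isCont_tendsto_compose[OF cont lim[OF pw]] by auto
    qed (use bd in auto)
    then show "(\<lambda>n. integral\<^sup>L (distr \<Omega> borel (\<lambda>x. g n (Y_seq n x))) f)
        \<longlonglongrightarrow> integral\<^sup>L (distr \<Omega> borel (\<lambda>x. h (Y x))) f"
      by (simp add: integral_distr)
  qed
qed

text \<open>
  The scalar computation behind the limit law: \<open>1 + \<sigma> y / \<surd>t\<close> is the sample mean expressed
  through its standardised version \<open>y\<close>, and at the kink only its positive part survives the
  rescaling.
\<close>

lemma rescaled_multiplier_tendsto:
  fixes y :: "nat \<Rightarrow> real"
  assumes "y \<longlonglongrightarrow> x"
  shows "(\<lambda>t. sqrt (real t) * (1 / max 1 (1 + \<sigma> * y t / sqrt (real t)) - 1)) \<longlonglongrightarrow> - max 0 (\<sigma> * x)"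
proof -
  have "(\<lambda>t. y t * (1 / sqrt (real t))) \<longlonglongrightarrow> x * 0"
  proof (rule tendsto_mult[OF assms])
    have "filterlim (\<lambda>t. sqrt (real t)) at_top sequentially"
      by (rule filterlim_compose[OF sqrt_at_top filterlim_real_sequentially])
    then show "(\<lambda>t. 1 / sqrt (real t)) \<longlonglongrightarrow> 0"
      by (rule tendsto_divide_0[OF tendsto_const filterlim_at_top_imp_at_infinity])
  qed
  from tendsto_max[OF tendsto_const[of 1] tendsto_add[OF tendsto_const[of 1] tendsto_mult[OF tendsto_const[of \<sigma>] this]]]
  have "(\<lambda>t. max 1 (1 + \<sigma> * y t / sqrt (real t))) \<longlonglongrightarrow> 1"
    by simp
  then have "(\<lambda>t. - max 0 (\<sigma> * y t) / max 1 (1 + \<sigma> * y t / sqrt (real t))) \<longlonglongrightarrow> - max 0 (\<sigma> * x) / 1"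
    using assms by (intro tendsto_divide tendsto_minus tendsto_max tendsto_mult tendsto_const) auto
  moreover have "\<forall>\<^sub>F t in sequentially. - max 0 (\<sigma> * y t) / max 1 (1 + \<sigma> * y t / sqrt (real t))
      = sqrt (real t) * (1 / max 1 (1 + \<sigma> * y t / sqrt (real t)) - 1)"
    using eventually_gt_at_top[of 0]
  proof eventually_elim
    case (elim t)
    show ?case
    proof (cases "0 \<le> \<sigma> * y t")
      case True
      then have "max 1 (1 + \<sigma> * y t / sqrt (real t)) = 1 + \<sigma> * y t / sqrt (real t)"
        "0 < 1 + \<sigma> * y t / sqrt (real t)" using elim
        by (auto intro!: add_pos_nonneg)
      then show ?thesis using True elim by (simp add: field_simps)
    next
      case False
      then show ?thesis using elim by (simp add: max_def field_simps)
    qed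
  qed
  ultimately show ?thesis
    by (simp add: tendsto_cong)
qed

lemma null_sets_std_normal: "null_sets std_normal_distribution = null_sets lborel"
proof -
  have "A \<in> null_sets std_normal_distribution \<longleftrightarrow> A \<in> null_sets lborel" for A
  proof (cases "A \<in> sets lborel")
    case True
    have "A \<in> null_sets std_normal_distribution \<longleftrightarrow> (AE x in lborel. x \<notin> A)"
      using True normal_density_pos[of 1 0]
      by (subst null_sets_density_iff) (auto simp: less_le)
    then show ?thesis using True by (simp add: AE_iff_null_sets)
  qed (auto simp: null_sets_def)
  then show ?thesis by blast
qed

text \<open>
  Used twice: the left half-lines make the data event in the main argument asymptotically
  nonnegligible, and the right half-line makes the limit law charge the negative numbers.
\<close>

lemma std_normal_half_line_not_null:
  fixes a :: real
  shows "{..<a} \<notin> null_sets std_normal_distribution" "{a<..} \<notin> null_sets std_normal_distribution"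
proof -
  have "S \<notin> null_sets std_normal_distribution" if "{b<..<b + 1} \<subseteq> S" for b :: real and S
  proof
    assume "S \<in> null_sets std_normal_distribution"
    then have "{b<..<b + 1} \<in> null_sets lborel"
      unfolding null_sets_std_normal by (rule null_sets_subset) (use that in auto)
    then show False by (simp add: null_sets_def)
  qed
  note * = this
  show "{..<a} \<notin> null_sets std_normal_distribution"
    by (rule *[of "a - 1"]) auto
  show "{a<..} \<notin> null_sets std_normal_distribution"
    by (rule *[of a]) auto
qed

definition censored_normal :: "real \<Rightarrow> real measure" where
  "censored_normal \<sigma> = distr std_normal_distribution borel (\<lambda>x. - max 0 (\<sigma> * x))"

lemma real_distribution_censored_normal: "real_distribution (censored_normal \<sigma>)"
proof -
  interpret N: real_distribution std_normal_distribution by (rule real_dist_normal_dist)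
  show ?thesis unfolding censored_normal_def by (rule N.real_distribution_distr) simp
qed

text \<open>
  A test function in \<open>BL1\<close> that sees only the negative half-line.  The limit law has mass there,
  whereas the bootstrap error rarely gets there when the sample mean is well below the kink.
\<close>

definition clipped_neg :: "real \<Rightarrow> real" where
  "clipped_neg x = max (- 1) (min 0 x)"

lemma clipped_neg_bounds: "\<bar>clipped_neg x\<bar> \<le> 1" "clipped_neg x \<le> 0"
  by (auto simp: clipped_neg_def)

lemma clipped_neg_BL1: "clipped_neg \<in> BL1"
  unfolding BL1_def clipped_neg_def by (simp add: max_def min_def)

lemma isCont_clipped_neg: "isCont clipped_neg x"
  unfolding clipped_neg_def by (intro continuous_intros)

lemma borel_measurable_clipped_neg[measurable]: "clipped_neg \<in> borel_measurable borel"
  unfolding clipped_neg_def by measurable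

lemma integral_clipped_neg_censored_normal:
  assumes "0 < \<sigma>"
  shows "(\<integral>x. clipped_neg x \<partial>censored_normal \<sigma>) < 0"
proof -
  interpret N: real_distribution std_normal_distribution by (rule real_dist_normal_dist)
  define u where "u = (\<lambda>x. - clipped_neg (- max 0 (\<sigma> * x)))"
  have u: "0 \<le> u x" "\<bar>u x\<bar> \<le> 1" for x
    using clipped_neg_bounds by (auto simp: u_def)
  have u_meas: "u \<in> borel_measurable borel" unfolding u_def by measurable
  have u_int: "integrable std_normal_distribution u"
    using u u_meas by (intro N.integrable_const_bound[where B = 1]) auto
  have eq: "(\<integral>x. clipped_neg x \<partial>censored_normal \<sigma>) = - integral\<^sup>L std_normal_distribution u"
    unfolding censored_normal_def u_def by (subst integral_distr) auto
  have "integral\<^sup>L std_normal_distribution u \<noteq> 0"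
  proof
    assume "integral\<^sup>L std_normal_distribution u = 0"
    then have "AE x in std_normal_distribution. u x = 0"
      using integral_nonneg_eq_0_iff_AE[OF u_int] u by simp
    then have "AE x in std_normal_distribution. x \<notin> {0<..}"
    proof eventually_elim
      case (elim x)
      show ?case
      proof
        assume "x \<in> {0<..}"
        then have "0 < \<sigma> * x" using assms by simp
        then show False using elim by (simp add: u_def clipped_neg_def)
      qed
    qed
    then have "{0<..} \<in> null_sets std_normal_distribution"
      by (subst (asm) AE_iff_null_sets[symmetric]) auto
    then show False using std_normal_half_line_not_null(2) by blast
  qed
  moreover have "0 \<le> integral\<^sup>L std_normal_distribution u" using u by simp
  ultimately show ?thesis using eq by linarith
qed

section \<open>Second moment of a resampled sum\<close>

lemma (in prob_space) expectation_mult_indicator_indep: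
  fixes X :: "'a \<Rightarrow> real"
  assumes indep: "indep_set (sets F) (sets G)" and F: "subalgebra M F" and G: "subalgebra M G"
    and X: "X \<in> borel_measurable F" "integrable M X" and B: "B \<in> sets G"
  shows "(\<integral>\<omega>. X \<omega> * indicator B \<omega> \<partial>M) = expectation X * prob B"
proof -
  have sp: "space F = space M" "space G = space M"
    using F G by (auto simp: subalgebra_def)
  have B': "B \<in> events" using B G by (auto simp: subalgebra_def)
  have iB: "(indicator B :: 'a \<Rightarrow> real) \<in> borel_measurable G" using B by simp
  have "indep_var borel X borel (indicator B :: 'a \<Rightarrow> real)"
    unfolding indep_var_eq
  proof (intro conjI)
    have "{X -` A \<inter> space M |A. A \<in> sets borel} \<subseteq> sets F"
      using measurable_sets[OF X(1)] by (auto simp: sp)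
    then have 1: "sigma_sets (space M) {X -` A \<inter> space M |A. A \<in> sets borel} \<subseteq> sets F"
      using sets.sigma_sets_subset[of _ F] by (simp add: sp)
    have "{(indicator B :: 'a \<Rightarrow> real) -` A \<inter> space M |A. A \<in> sets borel} \<subseteq> sets G"
      using measurable_sets[OF iB] by (auto simp: sp)
    then have 2: "sigma_sets (space M) {(indicator B :: 'a \<Rightarrow> real) -` A \<inter> space M |A. A \<in> sets borel} \<subseteq> sets G"
      using sets.sigma_sets_subset[of _ G] by (simp add: sp)
    show "indep_set (sigma_sets (space M) {X -` A \<inter> space M |A. A \<in> sets borel})
      (sigma_sets (space M) {(indicator B :: 'a \<Rightarrow> real) -` A \<inter> space M |A. A \<in> sets borel})"
      using indep 1 2 unfolding indep_sets2_eq by blast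
  qed (use X(2) B' in auto)
  then have "(\<integral>\<omega>. X \<omega> * indicator B \<omega> \<partial>M) = expectation X * expectation (indicator B)"
    using X(2) B' by (intro indep_var_lebesgue_integral) (auto simp: emeasure_eq_measure)
  then show ?thesis using B' by simp
qed

text \<open>
  The conditional variance of a bootstrap sum, integrated over a data event \<open>A\<close>.  Positions are
  drawn uniformly and pairwise independently, so after expanding the square the terms with
  \<open>\<tau> \<noteq> \<tau>'\<close> average \<open>U i * U j\<close> over all pairs and vanish by centring, while each diagonal
  term contributes the average of \<open>(U i)\<^sup>2\<close>.  The \<open>\<sigma>\<close>-algebra \<open>F\<close> carries the data and
  \<open>G\<close> the drawn positions; independence of the two replaces conditioning on the data.
\<close>

lemma (in prob_space) resampled_sum_second_moment:
  fixes U :: "'i \<Rightarrow> 'a \<Rightarrow> real" and J :: "'j \<Rightarrow> 'a \<Rightarrow> 'i"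
  assumes I: "finite I" "I \<noteq> {}" and T: "finite T"
    and indep: "indep_set (sets F) (sets G)" and F: "subalgebra M F" and G: "subalgebra M G"
    and J: "\<And>\<tau>. \<tau> \<in> T \<Longrightarrow> J \<tau> \<in> G \<rightarrow>\<^sub>M count_space I"
    and unif: "\<And>\<tau> i. \<tau> \<in> T \<Longrightarrow> i \<in> I \<Longrightarrow> prob {\<omega>\<in>space M. J \<tau> \<omega> = i} = 1 / card I"
    and pair: "\<And>\<tau> \<tau>' i j. \<tau> \<in> T \<Longrightarrow> \<tau>' \<in> T \<Longrightarrow> \<tau> \<noteq> \<tau>' \<Longrightarrow> i \<in> I \<Longrightarrow> j \<in> I \<Longrightarrow>
      prob {\<omega>\<in>space M. J \<tau> \<omega> = i \<and> J \<tau>' \<omega> = j} = 1 / (card I)\<^sup>2"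
    and A: "A \<in> sets F"
    and U: "\<And>i. i \<in> I \<Longrightarrow> U i \<in> borel_measurable F"
    and U_bounded: "\<And>i \<omega>. i \<in> I \<Longrightarrow> \<omega> \<in> space M \<Longrightarrow> \<bar>U i \<omega>\<bar> \<le> C"
    and centred: "\<And>\<omega>. \<omega> \<in> space M \<Longrightarrow> (\<Sum>i\<in>I. U i \<omega>) = 0"
  shows "integrable M (\<lambda>\<omega>. indicator A \<omega> * (\<Sum>\<tau>\<in>T. U (J \<tau> \<omega>) \<omega>)\<^sup>2)"
    and "(\<integral>\<omega>. indicator A \<omega> * (\<Sum>\<tau>\<in>T. U (J \<tau> \<omega>) \<omega>)\<^sup>2 \<partial>M)
      = card T / card I * (\<Sum>i\<in>I. \<integral>\<omega>. indicator A \<omega> * (U i \<omega>)\<^sup>2 \<partial>M)"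
proof -
  have sp: "space F = space M" "space G = space M"
    using F G by (auto simp: subalgebra_def)
  define B where "B = (\<lambda>\<tau> \<tau>' i j. {\<omega>\<in>space M. J \<tau> \<omega> = i \<and> J \<tau>' \<omega> = j})"
  define X where "X = (\<lambda>i j \<omega>. indicator A \<omega> * (U i \<omega> * U j \<omega>))"
  have JI: "J \<tau> \<omega> \<in> I" if "\<tau> \<in> T" "\<omega> \<in> space M" for \<tau> \<omega>
    using measurable_space[OF J] that by (auto simp: sp)
  have B: "B \<tau> \<tau>' i j \<in> sets G" if "\<tau> \<in> T" "\<tau>' \<in> T" "i \<in> I" "j \<in> I" for \<tau> \<tau>' i j
  proof -
    have "J \<tau> -` {i} \<inter> space G \<inter> (J \<tau>' -` {j} \<inter> space G) \<in> sets G"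
      using that by (intro sets.Int measurable_sets[OF J]) auto
    also have "J \<tau> -` {i} \<inter> space G \<inter> (J \<tau>' -` {j} \<inter> space G) = B \<tau> \<tau>' i j"
      by (auto simp: B_def sp)
    finally show ?thesis .
  qed
  have X: "X i j \<in> borel_measurable F" if "i \<in> I" "j \<in> I" for i j
    using U that A unfolding X_def by measurable
  have X_int: "integrable M (X i j)" if "i \<in> I" "j \<in> I" for i j
  proof (rule integrable_const_bound[where B = "C * C"])
    show "X i j \<in> borel_measurable M" using measurable_from_subalg[OF F X] that .
    show "AE \<omega> in M. norm (X i j \<omega>) \<le> C * C"
    proof (rule AE_I2)
      fix \<omega> assume \<omega>: "\<omega> \<in> space M"
      have "\<bar>U i \<omega> * U j \<omega>\<bar> \<le> C * C"
        unfolding abs_mult using U_bounded[OF that(1) \<omega>] U_bounded[OF that(2) \<omega>]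
        by (intro mult_mono) auto
      moreover have "0 \<le> C * C" by simp
      ultimately show "norm (X i j \<omega>) \<le> C * C"
        by (simp add: X_def indicator_def)
    qed
  qed
  define W where "W = (\<lambda>\<tau> \<tau>' i j \<omega>. X i j \<omega> * indicator (B \<tau> \<tau>' i j) \<omega>)"
  have W_exp: "expectation (W \<tau> \<tau>' i j) = expectation (X i j) * prob (B \<tau> \<tau>' i j)"
    if "\<tau> \<in> T" "\<tau>' \<in> T" "i \<in> I" "j \<in> I" for \<tau> \<tau>' i j
    unfolding W_def using that by (intro expectation_mult_indicator_indep[OF indep F G] X X_int B)
  have W_int: "integrable M (W \<tau> \<tau>' i j)"
    if "\<tau> \<in> T" "\<tau>' \<in> T" "i \<in> I" "j \<in> I" for \<tau> \<tau>' i j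
    unfolding W_def using B[of \<tau> \<tau>' i j] G that
    by (intro integrable_real_mult_indicator X_int) (auto simp: subalgebra_def)
  have expand: "indicator A \<omega> * (\<Sum>\<tau>\<in>T. U (J \<tau> \<omega>) \<omega>)\<^sup>2
      = (\<Sum>\<tau>\<in>T. \<Sum>\<tau>'\<in>T. \<Sum>i\<in>I. \<Sum>j\<in>I. W \<tau> \<tau>' i j \<omega>)"
    if \<omega>: "\<omega> \<in> space M" for \<omega>
  proof -
    have "(\<Sum>i\<in>I. \<Sum>j\<in>I. W \<tau> \<tau>' i j \<omega>) = X (J \<tau> \<omega>) (J \<tau>' \<omega>) \<omega>"
      if "\<tau> \<in> T" "\<tau>' \<in> T" for \<tau> \<tau>'
    proof -
      have "(\<Sum>i\<in>I. \<Sum>j\<in>I. W \<tau> \<tau>' i j \<omega>)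
          = (\<Sum>i\<in>I. if i = J \<tau> \<omega> then (\<Sum>j\<in>I. if j = J \<tau>' \<omega> then X i j \<omega> else 0) else 0)"
        using \<omega> by (intro sum.cong) (auto simp: W_def B_def indicator_def intro!: sum.cong)
      also have "\<dots> = X (J \<tau> \<omega>) (J \<tau>' \<omega>) \<omega>"
        using I JI[OF _ \<omega>] that by simp
      finally show ?thesis .
    qed
    then have "(\<Sum>\<tau>\<in>T. \<Sum>\<tau>'\<in>T. \<Sum>i\<in>I. \<Sum>j\<in>I. W \<tau> \<tau>' i j \<omega>) = (\<Sum>\<tau>\<in>T. \<Sum>\<tau>'\<in>T. X (J \<tau> \<omega>) (J \<tau>' \<omega>) \<omega>)"
      by (intro sum.cong refl)
    also have "\<dots> = indicator A \<omega> * (\<Sum>\<tau>\<in>T. U (J \<tau> \<omega>) \<omega>)\<^sup>2"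
      unfolding X_def by (simp only: power2_eq_square sum_distrib_left[symmetric] sum_distrib_right[symmetric])
    finally show ?thesis by simp
  qed
  show "integrable M (\<lambda>\<omega>. indicator A \<omega> * (\<Sum>\<tau>\<in>T. U (J \<tau> \<omega>) \<omega>)\<^sup>2)"
    by (subst Bochner_Integration.integrable_cong[OF refl expand])
      (assumption, intro Bochner_Integration.integrable_sum W_int)
  have cov: "(\<Sum>i\<in>I. \<Sum>j\<in>I. expectation (X i j) * prob (B \<tau> \<tau>' i j)) =
      (if \<tau> = \<tau>' then (\<Sum>i\<in>I. expectation (X i i)) / card I else 0)"
    if "\<tau> \<in> T" "\<tau>' \<in> T" for \<tau> \<tau>'
  proof (cases "\<tau> = \<tau>'")
    case True
    have prob_diag: "prob (B \<tau> \<tau> i j) = (if j = i then 1 / card I else 0)" if "i \<in> I" "j \<in> I" for i j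
    proof (cases "j = i")
      case False
      then have "B \<tau> \<tau> i j = {}" by (auto simp: B_def)
      then show ?thesis using False by simp
    qed (use unif[OF \<open>\<tau> \<in> T\<close> \<open>i \<in> I\<close>] in \<open>simp add: B_def\<close>)
    have "(\<Sum>j\<in>I. expectation (X i j) * prob (B \<tau> \<tau> i j)) = expectation (X i i) / card I" if "i \<in> I" for i
    proof -
      have "(\<Sum>j\<in>I. expectation (X i j) * prob (B \<tau> \<tau> i j))
          = (\<Sum>j\<in>I. if j = i then expectation (X i j) / card I else 0)"
        using prob_diag that by (intro sum.cong refl) auto
      then show ?thesis using I that by simp
    qed
    then show ?thesis using True by (simp add: sum_divide_distrib)
  next
    case False
    have "(\<Sum>i\<in>I. \<Sum>j\<in>I. X i j \<omega>) = 0" if "\<omega> \<in> space M" for \<omega>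
    proof -
      have "(\<Sum>i\<in>I. \<Sum>j\<in>I. X i j \<omega>) = indicator A \<omega> * ((\<Sum>i\<in>I. U i \<omega>) * (\<Sum>j\<in>I. U j \<omega>))"
        unfolding X_def by (simp only: sum_distrib_left[symmetric] sum_distrib_right[symmetric])
      then show ?thesis using centred[OF that] by simp
    qed
    then have "0 = (\<integral>\<omega>. (\<Sum>i\<in>I. \<Sum>j\<in>I. X i j \<omega>) \<partial>M)"
      by (subst Bochner_Integration.integral_cong[OF refl, of M _ "\<lambda>_. 0"]) auto
    also have "\<dots> = (\<Sum>i\<in>I. \<Sum>j\<in>I. expectation (X i j))"
      by (simp add: Bochner_Integration.integral_sum Bochner_Integration.integrable_sum X_int cong: sum.cong)
    finally have "(\<Sum>i\<in>I. \<Sum>j\<in>I. expectation (X i j)) = 0" by simp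
    moreover have "(\<Sum>i\<in>I. \<Sum>j\<in>I. expectation (X i j) * prob (B \<tau> \<tau>' i j))
        = (\<Sum>i\<in>I. \<Sum>j\<in>I. expectation (X i j)) * (1 / (card I)\<^sup>2)"
      unfolding sum_distrib_right using pair[OF that False] by (intro sum.cong refl) (simp add: B_def)
    ultimately show ?thesis using False by simp
  qed
  have "(\<integral>\<omega>. indicator A \<omega> * (\<Sum>\<tau>\<in>T. U (J \<tau> \<omega>) \<omega>)\<^sup>2 \<partial>M)
      = (\<integral>\<omega>. (\<Sum>\<tau>\<in>T. \<Sum>\<tau>'\<in>T. \<Sum>i\<in>I. \<Sum>j\<in>I. W \<tau> \<tau>' i j \<omega>) \<partial>M)"
    by (rule Bochner_Integration.integral_cong[OF refl expand])
  also have "\<dots> = (\<Sum>\<tau>\<in>T. \<Sum>\<tau>'\<in>T. \<Sum>i\<in>I. \<Sum>j\<in>I. expectation (W \<tau> \<tau>' i j))"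
    by (simp add: Bochner_Integration.integral_sum Bochner_Integration.integrable_sum W_int cong: sum.cong)
  also have "\<dots> = (\<Sum>\<tau>\<in>T. \<Sum>\<tau>'\<in>T. \<Sum>i\<in>I. \<Sum>j\<in>I. expectation (X i j) * prob (B \<tau> \<tau>' i j))"
    by (intro sum.cong refl W_exp)
  also have "\<dots> = (\<Sum>\<tau>\<in>T. \<Sum>\<tau>'\<in>T. if \<tau> = \<tau>' then (\<Sum>i\<in>I. expectation (X i i)) / card I else 0)"
    using cov by (intro sum.cong) auto
  also have "\<dots> = card T / card I * (\<Sum>i\<in>I. expectation (X i i))"
    using T by simp
  finally show "(\<integral>\<omega>. indicator A \<omega> * (\<Sum>\<tau>\<in>T. U (J \<tau> \<omega>) \<omega>)\<^sup>2 \<partial>M)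
      = card T / card I * (\<Sum>i\<in>I. \<integral>\<omega>. indicator A \<omega> * (U i \<omega>)\<^sup>2 \<partial>M)"
    by (simp add: X_def power2_eq_square)
qed

section \<open>Consistency seen on data events\<close>

text \<open>
  Consistency bounds a supremum over uncountably many test functions, which need not be measurable
  and is controlled in outer measure only.  For a single \<open>f\<close> the integral \<open>h t\<close> of \<open>f\<close> against
  the conditional law is measurable, is dominated by that supremum, and has the same integral over
  a data event as \<open>f\<close> of the variable itself.  Convergence in probability then becomes convergence
  of these integrals, since everything is bounded.
\<close>

lemma (in prob_space) consistently_estimates_on_data_events:
  assumes cons: "consistently_estimates M F X L" and L: "real_distribution L"
    and F: "\<And>t. subalgebra M (F t)"
    and X[measurable]: "\<And>t. X t \<in> borel_measurable M"
    and f: "f \<in> BL1" and A: "\<And>t. A t \<in> sets (F t)"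
  shows "(\<lambda>t. (\<integral>\<omega>. indicator (A t) \<omega> * f (X t \<omega>) \<partial>M) - prob (A t) * (\<integral>x. f x \<partial>L)) \<longlonglongrightarrow> 0"
proof -
  interpret L: real_distribution L by fact
  obtain K where cond: "\<And>t. cond_distribution M (F t) (X t) (K t)"
    and tends: "tends_to_0_in_prob M (\<lambda>t \<omega>. SUP f\<in>BL1. \<bar>(\<integral>x. f x \<partial>K t \<omega>) - (\<integral>x. f x \<partial>L)\<bar>)"
    using cons unfolding consistently_estimates_def by blast
  have f_bd: "\<bar>f x\<bar> \<le> 1" and f_lip: "\<bar>f x - f y\<bar> \<le> \<bar>x - y\<bar>" if "f \<in> BL1" for f x y
    using that by (auto simp: BL1_def)
  have BL1_meas: "f \<in> borel_measurable borel" if "f \<in> BL1" for f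
  proof -
    have "1-lipschitz_on UNIV f"
      using f_lip[OF that] by (auto simp: lipschitz_on_def dist_real_def)
    then show ?thesis
      by (intro borel_measurable_continuous_onI lipschitz_on_continuous_on)
  qed
  note [measurable] = BL1_meas[OF f]
  have int_le: "\<bar>\<integral>x. f x \<partial>N\<bar> \<le> 1" if "prob_space N" "f \<in> BL1" for N :: "real measure" and f
  proof -
    interpret N: prob_space N by fact
    have "\<bar>\<integral>x. f x \<partial>N\<bar> \<le> (\<integral>x. \<bar>f x\<bar> \<partial>N)" by (rule integral_abs_bound)
    also have "\<dots> \<le> 1"
      using f_bd[OF that(2)] by (cases "integrable N (\<lambda>x. \<bar>f x\<bar>)")
        (auto intro!: N.integral_le_const simp: not_integrable_integral_eq)
    finally show ?thesis .
  qed
  define l where "l = (\<integral>x. f x \<partial>L)"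
  define h where "h = (\<lambda>t \<omega>. \<integral>x. f x \<partial>K t \<omega>)"
  have Kp: "prob_space (K t \<omega>)" if "\<omega> \<in> space M" for t \<omega>
    using measurable_space[of "K t" "F t" "prob_algebra borel" \<omega>] cond[of t] F[of t] that
    by (auto simp: cond_distribution_def space_prob_algebra subalgebra_def)
  have h_bd: "\<bar>h t \<omega> - l\<bar> \<le> 2" if "\<omega> \<in> space M" for t \<omega>
    using int_le[OF Kp[OF that] f, of t] int_le[OF L.prob_space_axioms f] unfolding h_def l_def by linarith
  have [measurable]: "h t \<in> borel_measurable M" for t
  proof -
    have "K t \<in> F t \<rightarrow>\<^sub>M subprob_algebra borel"
      using cond[of t] unfolding cond_distribution_def by (auto dest: measurable_prob_algebraD)
    then have "h t \<in> borel_measurable (F t)" unfolding h_def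
      by (rule measurable_compose) (intro integral_measurable_subprob_algebra, measurable)
    then show ?thesis by (rule measurable_from_subalg[OF F])
  qed
  have AM[measurable]: "A t \<in> events" for t
    using A[of t] F[of t] by (auto simp: subalgebra_def)
  have fX_int: "integrable M (\<lambda>\<omega>. f (X t \<omega>))" for t
    using f_bd[OF f] by (intro integrable_const_bound[where B = 1]) auto
  have disint: "(\<integral>\<omega>. indicator (A t) \<omega> * f (X t \<omega>) \<partial>M) = (\<integral>\<omega>. indicator (A t) \<omega> * h t \<omega> \<partial>M)" for t
  proof -
    interpret finite_measure_subalgebra M "F t"
      using F by (auto simp: finite_measure_subalgebra_def finite_measure_subalgebra_axioms_def finite_measure_axioms)
    have "bounded (range f)" using f_bd[OF f] by (auto simp: bounded_iff)
    then have AE: "AE \<omega> in M. real_cond_exp M (F t) (\<lambda>\<omega>. f (X t \<omega>)) \<omega> = h t \<omega>"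
      using cond[of t] BL1_meas[OF f] unfolding cond_distribution_def h_def by blast
    have "(\<integral>\<omega>. indicator (A t) \<omega> * f (X t \<omega>) \<partial>M)
        = (\<integral>\<omega>. indicator (A t) \<omega> * real_cond_exp M (F t) (\<lambda>\<omega>. f (X t \<omega>)) \<omega> \<partial>M)"
      using real_cond_exp_intA[OF fX_int A[of t]] by (simp add: set_lebesgue_integral_def)
    also have "\<dots> = (\<integral>\<omega>. indicator (A t) \<omega> * h t \<omega> \<partial>M)"
      using AE by (intro integral_cong_AE) auto
    finally show ?thesis .
  qed
  \<comment> \<open>split according to whether the conditional integral is \<open>\<epsilon>\<close>-close to its limit; the distance
    never exceeds \<open>2\<close>\<close>
  have bound: "\<bar>(\<integral>\<omega>. indicator (A t) \<omega> * f (X t \<omega>) \<partial>M) - prob (A t) * l\<bar>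
      \<le> \<epsilon> + 2 * prob {\<omega>\<in>space M. \<bar>h t \<omega> - l\<bar> > \<epsilon>}" if "\<epsilon> > 0" for t \<epsilon>
  proof -
    have hint: "integrable M (\<lambda>\<omega>. indicator (A t) \<omega> * h t \<omega>)"
    proof (rule integrable_const_bound[where B = 1])
      show "AE \<omega> in M. norm (indicator (A t) \<omega> * h t \<omega>) \<le> 1"
        using int_le[OF Kp f] by (intro AE_I2) (simp add: h_def indicator_def)
    qed measurable
    define D where "D = {\<omega>\<in>space M. \<bar>h t \<omega> - l\<bar> > \<epsilon>}"
    have D[measurable]: "D \<in> events" unfolding D_def by measurable
    have "integrable M (\<lambda>\<omega>. indicator (A t) \<omega> * l)" "prob (A t) * l = (\<integral>\<omega>. indicator (A t) \<omega> * l \<partial>M)"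
      by (auto simp: emeasure_eq_measure)
    then have "(\<integral>\<omega>. indicator (A t) \<omega> * f (X t \<omega>) \<partial>M) - prob (A t) * l
        = (\<integral>\<omega>. indicator (A t) \<omega> * (h t \<omega> - l) \<partial>M)"
      unfolding disint right_diff_distrib using hint by (subst Bochner_Integration.integral_diff) auto
    also have "\<bar>\<dots>\<bar> \<le> (\<integral>\<omega>. \<bar>indicator (A t) \<omega> * (h t \<omega> - l)\<bar> \<partial>M)"
      by (rule integral_abs_bound)
    also have "\<dots> \<le> (\<integral>\<omega>. \<epsilon> + 2 * indicator D \<omega> \<partial>M)"
    proof (rule integral_mono')
      show "\<bar>indicator (A t) \<omega> * (h t \<omega> - l)\<bar> \<le> \<epsilon> + 2 * indicator D \<omega>"
        if "\<omega> \<in> space M" for \<omega>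
        using h_bd[OF that, of t] that \<open>\<epsilon> > 0\<close> by (auto simp: indicator_def D_def)
    qed (use \<open>\<epsilon> > 0\<close> D in \<open>simp_all add: emeasure_eq_measure\<close>)
    also have "\<dots> = \<epsilon> + 2 * prob D"
      using D by (simp add: prob_space emeasure_eq_measure)
    finally show ?thesis unfolding D_def .
  qed
  have prob_lim: "(\<lambda>t. prob {\<omega>\<in>space M. \<bar>h t \<omega> - l\<bar> > \<epsilon>}) \<longlonglongrightarrow> 0" if "\<epsilon> > 0" for \<epsilon>
  proof -
    define S where "S = (\<lambda>t \<omega>. SUP f\<in>BL1. \<bar>(\<integral>x. f x \<partial>K t \<omega>) - (\<integral>x. f x \<partial>L)\<bar>)"
    have hS: "\<bar>h t \<omega> - l\<bar> \<le> S t \<omega>" if "\<omega> \<in> space M" for t \<omega>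
      unfolding h_def l_def S_def
    proof (rule cSUP_upper[OF f])
      show "bdd_above ((\<lambda>f. \<bar>(\<integral>x. f x \<partial>K t \<omega>) - (\<integral>x. f x \<partial>L)\<bar>) ` BL1)"
      proof (rule bdd_aboveI2)
        show "\<bar>(\<integral>x. f x \<partial>K t \<omega>) - (\<integral>x. f x \<partial>L)\<bar> \<le> 2" if "f \<in> BL1" for f
          using int_le[OF Kp[OF \<open>\<omega> \<in> space M\<close>, of t] that] int_le[OF L.prob_space_axioms that] by linarith
      qed
    qed
    have S_lim: "(\<lambda>t. outer_measure_of M {\<omega>\<in>space M. \<bar>S t \<omega>\<bar> > \<epsilon>}) \<longlonglongrightarrow> 0"
      using tends \<open>\<epsilon> > 0\<close> unfolding tends_to_0_in_prob_def S_def by blast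
    have h_le: "ennreal (prob {\<omega>\<in>space M. \<bar>h t \<omega> - l\<bar> > \<epsilon>}) \<le> outer_measure_of M {\<omega>\<in>space M. \<bar>S t \<omega>\<bar> > \<epsilon>}" for t
    proof -
      have "ennreal (prob {\<omega>\<in>space M. \<bar>h t \<omega> - l\<bar> > \<epsilon>}) = outer_measure_of M {\<omega>\<in>space M. \<bar>h t \<omega> - l\<bar> > \<epsilon>}"
        by (subst outer_measure_of_eq) (auto simp: emeasure_eq_measure)
      also have "\<dots> \<le> outer_measure_of M {\<omega>\<in>space M. \<bar>S t \<omega>\<bar> > \<epsilon>}"
        
      proof (rule outer_measure_of_mono, safe)
        fix \<omega> assume "\<omega> \<in> space M" "\<epsilon> < \<bar>h t \<omega> - l\<bar>"
        then show "\<epsilon> < \<bar>S t \<omega>\<bar>" using hS[of \<omega> t] by linarith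
      qed
      finally show ?thesis .
    qed
    have "(\<lambda>t. ennreal (prob {\<omega>\<in>space M. \<bar>h t \<omega> - l\<bar> > \<epsilon>})) \<longlonglongrightarrow> 0"
    proof (rule tendsto_sandwich)
      show "\<forall>\<^sub>F t in sequentially. (0::ennreal) \<le> ennreal (prob {\<omega>\<in>space M. \<bar>h t \<omega> - l\<bar> > \<epsilon>})"
        by simp
      show "\<forall>\<^sub>F t in sequentially. ennreal (prob {\<omega>\<in>space M. \<bar>h t \<omega> - l\<bar> > \<epsilon>})
          \<le> outer_measure_of M {\<omega>\<in>space M. \<bar>S t \<omega>\<bar> > \<epsilon>}"
        by (intro always_eventually allI h_le)
    qed (use S_lim in simp_all)
    then have "(\<lambda>t. ennreal (prob {\<omega>\<in>space M. \<bar>h t \<omega> - l\<bar> > \<epsilon>})) \<longlonglongrightarrow> ennreal 0"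
      by (simp only: ennreal_0)
    then show ?thesis by (subst (asm) tendsto_ennreal_iff) (simp_all add: measure_nonneg)
  qed
  show ?thesis unfolding l_def[symmetric]
  proof (rule LIMSEQ_I)
    fix r :: real assume "0 < r"
    then have "\<forall>\<^sub>F t in sequentially. prob {\<omega>\<in>space M. \<bar>h t \<omega> - l\<bar> > r / 2} < r / 4"
      using order_tendstoD(2)[OF prob_lim, of "r / 2" "r / 4"] by simp
    then have "\<forall>\<^sub>F t in sequentially. norm ((\<integral>\<omega>. indicator (A t) \<omega> * f (X t \<omega>) \<partial>M) - prob (A t) * l - 0) < r"
    proof eventually_elim
      case (elim t)
      then show ?case using bound[of "r / 2" t] \<open>0 < r\<close> by simp
    qed
    then show "\<exists>no. \<forall>n\<ge>no. norm ((\<integral>\<omega>. indicator (A n) \<omega> * f (X n \<omega>) \<partial>M) - prob (A n) * l - 0) < r"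
      by (simp add: eventually_sequentially)
  qed
qed

lemma
  assumes "\<And>\<tau>. \<tau> \<in> {1..t} \<Longrightarrow> Z \<tau> \<in> M \<rightarrow>\<^sub>M N"
  shows subalgebra_data_algebra: "subalgebra M (data_algebra M N Z t)"
    and measurable_data_algebra: "i \<in> {1..t} \<Longrightarrow> Z i \<in> data_algebra M N Z t \<rightarrow>\<^sub>M N"
proof -
  have vec: "sample_vec Z t \<in> M \<rightarrow>\<^sub>M (\<Pi>\<^sub>M \<tau>\<in>{1..t}. N)"
    unfolding sample_vec_def using assms by (rule measurable_restrict)
  then show "subalgebra M (data_algebra M N Z t)"
    unfolding subalgebra_def data_algebra_def
    by (auto intro: sets_image_in_sets[THEN subsetD])
  assume i: "i \<in> {1..t}"
  have "sample_vec Z t \<in> data_algebra M N Z t \<rightarrow>\<^sub>M (\<Pi>\<^sub>M \<tau>\<in>{1..t}. N)"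
    unfolding data_algebra_def using measurable_space[OF vec] by (intro measurable_vimage_algebra1) auto
  then have "(\<lambda>\<omega>. sample_vec Z t \<omega> i) \<in> data_algebra M N Z t \<rightarrow>\<^sub>M N"
    by (rule measurable_compose) (rule measurable_component_singleton[OF i])
  moreover have "(\<lambda>\<omega>. sample_vec Z t \<omega> i) = Z i"
    using i by (auto simp: sample_vec_def)
  ultimately show "Z i \<in> data_algebra M N Z t \<rightarrow>\<^sub>M N"
    by (simp only:)
qed

section \<open>Inconsistency for bounded draws of mean one\<close>

text \<open>
  The setting reduced to the real-valued valuations \<open>V \<tau>\<close> of the drawn items.  The data
  \<open>\<sigma>\<close>-algebras \<open>F t\<close> stay abstract because the original ones are generated by the items, which may
  carry more information than their valuations.
\<close>

locale resampled_draws = prob_space M for M :: "'w measure" +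
  fixes V :: "nat \<Rightarrow> 'w \<Rightarrow> real" and F :: "nat \<Rightarrow> 'w measure"
    and J :: "nat \<Rightarrow> nat \<Rightarrow> 'w \<Rightarrow> nat" and B \<sigma> :: real
  assumes V_bounds: "1 \<le> \<tau> \<Longrightarrow> \<omega> \<in> space M \<Longrightarrow> 0 \<le> V \<tau> \<omega> \<and> V \<tau> \<omega> \<le> B"
    and B_pos: "0 < B"
    and V_indep: "indep_vars (\<lambda>_. borel) (\<lambda>i. V (Suc i)) UNIV"
    and V_distr: "1 \<le> \<tau> \<Longrightarrow> distr M borel (V \<tau>) = distr M borel (V 1)"
    and V_mean: "1 \<le> \<tau> \<Longrightarrow> expectation (V \<tau>) = 1"
    and V_variance: "1 \<le> \<tau> \<Longrightarrow> variance (V \<tau>) = \<sigma>\<^sup>2"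
    and \<sigma>_pos: "0 < \<sigma>"
    and F_sub: "subalgebra M (F t)"
    and V_F: "i \<in> {1..t} \<Longrightarrow> V i \<in> borel_measurable (F t)"
    and J_indep: "0 < t \<Longrightarrow> indep_vars (\<lambda>_. count_space {1..t}) (J t) {1..t}"
    and J_distr: "\<tau> \<in> {1..t} \<Longrightarrow> distr M (count_space {1..t}) (J t \<tau>) = uniform_count_measure {1..t}"
    and J_data: "0 < t \<Longrightarrow>
      indep_set (sets (F t)) (sets (data_algebra M (count_space {1..t}) (J t) t))"
begin

definition data_mean :: "nat \<Rightarrow> 'w \<Rightarrow> real" where
  "data_mean t \<omega> = sample_mean (\<lambda>\<tau>. V \<tau> \<omega>) t"

definition boot_mean :: "nat \<Rightarrow> 'w \<Rightarrow> real" where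
  "boot_mean t \<omega> = sample_mean (\<lambda>\<tau>. V (J t \<tau> \<omega>) \<omega>) t"

text \<open>
  The data event of the main argument: the sample mean lies below the kink by at least \<open>K\<close> on the
  scale of the central limit theorem.
\<close>

definition low_mean :: "real \<Rightarrow> nat \<Rightarrow> 'w set" where
  "low_mean K t = {\<omega>\<in>space M. K \<le> sqrt (real t) * (1 - data_mean t \<omega>)}"

lemma V_measurable: "1 \<le> \<tau> \<Longrightarrow> V \<tau> \<in> borel_measurable M"
  using measurable_from_subalg[OF F_sub V_F[of \<tau> \<tau>]] by simp

lemma data_mean_F: "data_mean t \<in> borel_measurable (F t)"
  unfolding data_mean_def sample_mean_def
  by (intro borel_measurable_divide borel_measurable_sum V_F) auto

lemma data_mean_measurable[measurable]: "data_mean t \<in> borel_measurable M"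
  by (rule measurable_from_subalg[OF F_sub data_mean_F])

lemma low_mean_F: "low_mean K t \<in> sets (F t)"
proof -
  have "{\<omega>\<in>space (F t). K \<le> sqrt (real t) * (1 - data_mean t \<omega>)} \<in> sets (F t)"
    using data_mean_F by measurable
  then show ?thesis using F_sub[of t] by (simp add: low_mean_def subalgebra_def)
qed

lemma low_mean_events[measurable]: "low_mean K t \<in> events"
  unfolding low_mean_def by measurable

lemma J_measurable:
  assumes "\<tau> \<in> {1..t}"
  shows "J t \<tau> \<in> M \<rightarrow>\<^sub>M count_space {1..t}"
proof -
  have "0 < t" using assms by simp
  from J_indep[OF this] show ?thesis
    using assms unfolding indep_vars_def by blast
qed

lemma J_range: "\<tau> \<in> {1..t} \<Longrightarrow> \<omega> \<in> space M \<Longrightarrow> J t \<tau> \<omega> \<in> {1..t}"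
  using measurable_space[OF J_measurable, of \<tau> t \<omega>] by (simp only: space_count_space)

lemma boot_mean_measurable[measurable]: "boot_mean t \<in> borel_measurable M"
proof -
  have "(\<lambda>\<omega>. V (J t \<tau> \<omega>) \<omega>) \<in> borel_measurable M" if "\<tau> \<in> {1..t}" for \<tau>
  proof (rule measurable_compose_countable'[where f = V and g = "J t \<tau>" and I = "{1..t}"])
    show "V i \<in> borel_measurable M" if "i \<in> {1..t}" for i
      using that by (intro V_measurable) simp
  qed (use J_measurable[OF that] in simp_all)
  then show ?thesis unfolding boot_mean_def sample_mean_def
    by (intro borel_measurable_divide borel_measurable_sum) auto
qed

lemma data_mean_nonneg: "\<omega> \<in> space M \<Longrightarrow> 0 \<le> data_mean t \<omega>"
  unfolding data_mean_def sample_mean_def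
  using V_bounds by (intro divide_nonneg_nonneg sum_nonneg) auto

lemma data_mean_le:
  assumes "\<omega> \<in> space M" "0 < t"
  shows "data_mean t \<omega> \<le> B"
proof -
  have "(\<Sum>\<tau>=1..t. V \<tau> \<omega>) \<le> (\<Sum>\<tau>=1..t. B)"
    using V_bounds assms(1) by (intro sum_mono) auto
  then show ?thesis
    using assms(2) by (simp add: data_mean_def sample_mean_def field_simps)
qed

lemma boot_mean_nonneg:
  assumes "\<omega> \<in> space M"
  shows "0 \<le> boot_mean t \<omega>"
  unfolding boot_mean_def sample_mean_def
proof (intro divide_nonneg_nonneg sum_nonneg)
  show "0 \<le> V (J t \<tau> \<omega>) \<omega>" if "\<tau> \<in> {1..t}" for \<tau>
    using J_range[OF that assms] V_bounds[OF _ assms] by simp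
qed simp

text \<open>The draws are numbered from \<open>1\<close>, while the central limit theorem sums over indices from \<open>0\<close>.\<close>

definition std_data_mean :: "nat \<Rightarrow> 'w \<Rightarrow> real" where
  "std_data_mean t \<omega> = (\<Sum>i<t. V (Suc i) \<omega> - 1) / sqrt (real t * \<sigma>\<^sup>2)"

lemma std_data_mean_measurable[measurable]: "std_data_mean t \<in> borel_measurable M"
  unfolding std_data_mean_def using V_measurable
  by (intro borel_measurable_divide borel_measurable_sum borel_measurable_diff) auto

lemma data_mean_eq:
  assumes "0 < t"
  shows "data_mean t \<omega> = 1 + \<sigma> * std_data_mean t \<omega> / sqrt (real t)"
proof -
  define S where "S = (\<Sum>i<t. V (Suc i) \<omega> - 1)"
  have "(\<Sum>\<tau>=1..t. V \<tau> \<omega>) = S + real t"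
    by (simp add: S_def sum_subtractf sum.atLeast1_atMost_eq)
  then have "data_mean t \<omega> = 1 + S / real t"
    using assms by (simp add: data_mean_def sample_mean_def field_simps)
  also have "S / real t = S / (sqrt (real t) * sqrt (real t))" by simp
  also have "\<dots> = \<sigma> * (S / (sqrt (real t) * \<sigma>)) / sqrt (real t)"
    using \<sigma>_pos by (simp del: real_sqrt_mult_self)
  also have "sqrt (real t) * \<sigma> = sqrt (real t * \<sigma>\<^sup>2)"
    using \<sigma>_pos by (simp add: real_sqrt_mult)
  finally show ?thesis by (simp add: S_def std_data_mean_def)
qed

lemma real_distribution_std_data_mean: "real_distribution (distr M borel (std_data_mean t))"
  by (rule real_distribution_distr) simp

lemma std_data_mean_clt:
  "weak_conv_m (\<lambda>t. distr M borel (std_data_mean t)) std_normal_distribution"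
  unfolding std_data_mean_def
proof (rule central_limit_theorem[OF V_indep])
  show "integrable M (\<lambda>\<omega>. (V (Suc n) \<omega>)\<^sup>2)" for n
  proof (rule integrable_const_bound[where B = "B\<^sup>2"])
    show "AE \<omega> in M. norm ((V (Suc n) \<omega>)\<^sup>2) \<le> B\<^sup>2"
      using V_bounds[of "Suc n"] by (intro AE_I2) (simp add: power_mono)
    show "(\<lambda>\<omega>. (V (Suc n) \<omega>)\<^sup>2) \<in> borel_measurable M"
      using V_measurable[of "Suc n"] by simp
  qed
  show "distr M borel (V (Suc n)) = distr M borel (V 1)" for n
    by (rule V_distr) simp
qed (use V_mean V_variance \<sigma>_pos in auto)

lemma rescaled_multiplier_distr_eq:
  "distr M borel (\<lambda>\<omega>. sqrt (real t) * (1 / max 1 (data_mean t \<omega>) - 1))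
    = distr (distr M borel (std_data_mean t)) borel
        (\<lambda>y. sqrt (real t) * (1 / max 1 (1 + \<sigma> * y / sqrt (real t)) - 1))"
proof -
  have "sqrt (real t) * (1 / max 1 (data_mean t \<omega>) - 1)
      = sqrt (real t) * (1 / max 1 (1 + \<sigma> * std_data_mean t \<omega> / sqrt (real t)) - 1)" for \<omega>
    by (cases "t = 0") (simp_all add: data_mean_eq)
  then have "distr M borel (\<lambda>\<omega>. sqrt (real t) * (1 / max 1 (data_mean t \<omega>) - 1))
      = distr M borel ((\<lambda>y. sqrt (real t) * (1 / max 1 (1 + \<sigma> * y / sqrt (real t)) - 1)) \<circ> std_data_mean t)"
    by (intro distr_cong) (simp_all only: comp_def)
  also have "\<dots> = distr (distr M borel (std_data_mean t)) borel
      (\<lambda>y. sqrt (real t) * (1 / max 1 (1 + \<sigma> * y / sqrt (real t)) - 1))"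
    by (intro distr_distr[symmetric]) measurable
  finally show ?thesis .
qed

lemma real_distribution_rescaled_multiplier:
  "real_distribution (distr M borel (\<lambda>\<omega>. sqrt (real t) * (1 / max 1 (data_mean t \<omega>) - 1)))"
  by (rule real_distribution_distr) measurable

lemma rescaled_multiplier_weak_conv:
  "weak_conv_m (\<lambda>t. distr M borel (\<lambda>\<omega>. sqrt (real t) * (1 / max 1 (data_mean t \<omega>) - 1)))
    (censored_normal \<sigma>)"
  unfolding rescaled_multiplier_distr_eq censored_normal_def
proof (rule weak_conv_m_extended_mapping[OF real_distribution_std_data_mean real_dist_normal_dist
      std_data_mean_clt])
  show "(\<lambda>t. sqrt (real t) * (1 / max 1 (1 + \<sigma> * y t / sqrt (real t)) - 1)) \<longlonglongrightarrow> - max 0 (\<sigma> * x)"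
    if "y \<longlonglongrightarrow> x" for y x
    by (rule rescaled_multiplier_tendsto[OF that])
qed measurable

lemma prob_low_mean_tendsto:
  shows "(\<lambda>t. prob (low_mean K t)) \<longlonglongrightarrow> measure std_normal_distribution {..- K / \<sigma>}"
    and "0 < measure std_normal_distribution {..- K / \<sigma>}"
proof -
  interpret N: real_distribution std_normal_distribution by (rule real_dist_normal_dist)
  have "{- K / \<sigma>} \<in> null_sets std_normal_distribution"
    unfolding null_sets_std_normal by (simp add: null_sets_def)
  then have "emeasure std_normal_distribution (frontier {..- K / \<sigma>}) = 0"
    unfolding frontier_real_atMost by (rule null_setsD1)
  then have "(\<lambda>t. measure (distr M borel (std_data_mean t)) {..- K / \<sigma>})
      \<longlonglongrightarrow> measure std_normal_distribution {..- K / \<sigma>}"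
    by (intro weak_conv_imp_continuity_set_conv[OF real_distribution_std_data_mean
          real_dist_normal_dist std_data_mean_clt]) auto
  moreover have "\<forall>\<^sub>F t in sequentially.
      measure (distr M borel (std_data_mean t)) {..- K / \<sigma>} = prob (low_mean K t)"
    using eventually_gt_at_top[of 0]
  proof eventually_elim
    case (elim t)
    have "std_data_mean t \<omega> \<le> - K / \<sigma> \<longleftrightarrow> K \<le> sqrt (real t) * (1 - data_mean t \<omega>)" for \<omega>
    proof -
      have "sqrt (real t) * (1 - data_mean t \<omega>) = - (\<sigma> * std_data_mean t \<omega>)"
        using elim by (simp add: data_mean_eq)
      moreover have "std_data_mean t \<omega> \<le> - K / \<sigma> \<longleftrightarrow> \<sigma> * std_data_mean t \<omega> \<le> - K"
        using pos_le_divide_eq[OF \<sigma>_pos, of "std_data_mean t \<omega>" "- K"] by (simp only: mult.commute)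
      ultimately show ?thesis by linarith
    qed
    then have "std_data_mean t -` {..- K / \<sigma>} \<inter> space M = low_mean K t"
      by (auto simp: low_mean_def)
    then show ?case by (subst measure_distr) auto
  qed
  ultimately show "(\<lambda>t. prob (low_mean K t)) \<longlonglongrightarrow> measure std_normal_distribution {..- K / \<sigma>}"
    by (rule Lim_transform_eventually)
  have "{..- K / \<sigma>} \<notin> null_sets std_normal_distribution"
  proof
    assume "{..- K / \<sigma>} \<in> null_sets std_normal_distribution"
    then have "{..<- K / \<sigma>} \<in> null_sets std_normal_distribution"
      by (rule null_sets_subset) auto
    then show False using std_normal_half_line_not_null(1) by blast
  qed
  then have "measure std_normal_distribution {..- K / \<sigma>} \<noteq> 0"
    by (auto simp: null_sets_def N.emeasure_eq_measure)
  then show "0 < measure std_normal_distribution {..- K / \<sigma>}"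
    by (simp add: zero_less_measure_iff)
qed

lemma prob_J_eq:
  assumes "\<tau> \<in> {1..t}" "i \<in> {1..t}"
  shows "prob {\<omega>\<in>space M. J t \<tau> \<omega> = i} = 1 / real t"
proof -
  have "J t \<tau> -` {i} \<inter> space M = {\<omega>\<in>space M. J t \<tau> \<omega> = i}" by auto
  then have "prob {\<omega>\<in>space M. J t \<tau> \<omega> = i} = measure (distr M (count_space {1..t}) (J t \<tau>)) {i}"
    using assms J_measurable[OF assms(1)] by (subst measure_distr) auto
  also have "\<dots> = 1 / real t"
    unfolding J_distr[OF assms(1)] using assms by (subst measure_uniform_count_measure) auto
  finally show ?thesis .
qed

lemma prob_J_eq_pair:
  assumes "\<tau> \<in> {1..t}" "\<tau>' \<in> {1..t}" "\<tau> \<noteq> \<tau>'" "i \<in> {1..t}" "j \<in> {1..t}"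
  shows "prob {\<omega>\<in>space M. J t \<tau> \<omega> = i \<and> J t \<tau>' \<omega> = j} = 1 / (real t)\<^sup>2"
proof -
  have "indep_vars (\<lambda>_. count_space {1..t}) (J t) {1..t}"
    using assms by (intro J_indep) auto
  from indep_varsD[OF this, of "{\<tau>, \<tau>'}" "\<lambda>k. if k = \<tau> then {i} else {j}"]
  have "prob ((J t \<tau> -` {i} \<inter> space M) \<inter> (J t \<tau>' -` {j} \<inter> space M))
      = prob (J t \<tau> -` {i} \<inter> space M) * prob (J t \<tau>' -` {j} \<inter> space M)"
    using assms by simp
  moreover have "(J t \<tau> -` {i} \<inter> space M) \<inter> (J t \<tau>' -` {j} \<inter> space M)
      = {\<omega>\<in>space M. J t \<tau> \<omega> = i \<and> J t \<tau>' \<omega> = j}" by auto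
  moreover have "J t \<tau> -` {i} \<inter> space M = {\<omega>\<in>space M. J t \<tau> \<omega> = i}"
    "J t \<tau>' -` {j} \<inter> space M = {\<omega>\<in>space M. J t \<tau>' \<omega> = j}" by auto
  ultimately show ?thesis using prob_J_eq assms by (simp add: power2_eq_square)
qed

text \<open>
  Given the data, \<open>t\<close> times the squared deviation of the resampled mean has the sample variance as
  its mean, and the sample variance is at most \<open>B\<^sup>2\<close>.
\<close>

lemma boot_mean_variance:
  assumes t: "0 < t" and A: "A \<in> sets (F t)"
  shows "integrable M (\<lambda>\<omega>. indicator A \<omega> * (real t * (boot_mean t \<omega> - data_mean t \<omega>)\<^sup>2))"
    and "(\<integral>\<omega>. indicator A \<omega> * (real t * (boot_mean t \<omega> - data_mean t \<omega>)\<^sup>2) \<partial>M) \<le> B\<^sup>2 * prob A"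
proof -
  let ?G = "data_algebra M (count_space {1..t}) (J t) t"
  define U where "U = (\<lambda>i \<omega>. V i \<omega> - data_mean t \<omega>)"
  have U_bd: "\<bar>U i \<omega>\<bar> \<le> B" if "i \<in> {1..t}" "\<omega> \<in> space M" for i \<omega>
    using V_bounds[of i \<omega>] data_mean_nonneg[of \<omega> t] data_mean_le[of \<omega> t] that t by (auto simp: U_def)
  have U_F: "U i \<in> borel_measurable (F t)" if "i \<in> {1..t}" for i
    unfolding U_def using that by (intro borel_measurable_diff V_F data_mean_F)
  have centred: "(\<Sum>i\<in>{1..t}. U i \<omega>) = 0" for \<omega>
    using t by (simp add: U_def sum_subtractf data_mean_def sample_mean_def)
  have G_sub: "subalgebra M ?G"
    by (rule subalgebra_data_algebra) (rule J_measurable)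
  have J_G: "J t \<tau> \<in> ?G \<rightarrow>\<^sub>M count_space {1..t}" if "\<tau> \<in> {1..t}" for \<tau>
    by (rule measurable_data_algebra[OF J_measurable that])
  have dev: "real t * (boot_mean t \<omega> - data_mean t \<omega>)\<^sup>2 = (\<Sum>\<tau>\<in>{1..t}. U (J t \<tau> \<omega>) \<omega>)\<^sup>2 / real t" for \<omega>
  proof -
    have "(\<Sum>\<tau>\<in>{1..t}. U (J t \<tau> \<omega>) \<omega>) = real t * (boot_mean t \<omega> - data_mean t \<omega>)"
      using t by (simp add: U_def sum_subtractf boot_mean_def sample_mean_def right_diff_distrib)
    then show ?thesis using t by (simp add: power_mult_distrib power2_eq_square)
  qed
  have I: "finite {1..t}" "{1..t} \<noteq> {}" using t by auto
  have single: "prob {\<omega>\<in>space M. J t \<tau> \<omega> = i} = 1 / card {1..t}" if "\<tau> \<in> {1..t}" "i \<in> {1..t}" for \<tau> i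
    using prob_J_eq[OF that] by simp
  have pair: "prob {\<omega>\<in>space M. J t \<tau> \<omega> = i \<and> J t \<tau>' \<omega> = j} = 1 / (card {1..t})\<^sup>2"
    if "\<tau> \<in> {1..t}" "\<tau>' \<in> {1..t}" "\<tau> \<noteq> \<tau>'" "i \<in> {1..t}" "j \<in> {1..t}" for \<tau> \<tau>' i j
    using prob_J_eq_pair[OF that] by simp
  note moment = resampled_sum_second_moment[OF I I(1) J_data[OF t] F_sub G_sub J_G single pair A U_F U_bd centred]
  have moment_eq: "(\<integral>\<omega>. indicator A \<omega> * (\<Sum>\<tau>\<in>{1..t}. U (J t \<tau> \<omega>) \<omega>)\<^sup>2 \<partial>M)
      = (\<Sum>i\<in>{1..t}. \<integral>\<omega>. indicator A \<omega> * (U i \<omega>)\<^sup>2 \<partial>M)"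
    using moment(2) t by simp
  from moment(1) show "integrable M (\<lambda>\<omega>. indicator A \<omega> * (real t * (boot_mean t \<omega> - data_mean t \<omega>)\<^sup>2))"
    unfolding dev times_divide_eq_right by (rule integrable_divide)
  have A_ev: "A \<in> events" using A F_sub[of t] by (auto simp: subalgebra_def)
  have "(\<integral>\<omega>. indicator A \<omega> * (U i \<omega>)\<^sup>2 \<partial>M) \<le> B\<^sup>2 * prob A" if "i \<in> {1..t}" for i
  proof -
    have "(\<integral>\<omega>. indicator A \<omega> * (U i \<omega>)\<^sup>2 \<partial>M) \<le> (\<integral>\<omega>. B\<^sup>2 * indicator A \<omega> \<partial>M)"
    proof (rule integral_mono')
      show "integrable M (\<lambda>\<omega>. B\<^sup>2 * indicator A \<omega>)" using A_ev by (simp add: emeasure_eq_measure)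
      show "indicator A \<omega> * (U i \<omega>)\<^sup>2 \<le> B\<^sup>2 * indicator A \<omega>" if "\<omega> \<in> space M" for \<omega>
        using power_mono[OF U_bd[OF \<open>i \<in> {1..t}\<close> that] abs_ge_zero, of 2] by (simp add: indicator_def)
    qed simp
    then show ?thesis using A_ev by (simp add: emeasure_eq_measure)
  qed
  then have "(\<Sum>i\<in>{1..t}. \<integral>\<omega>. indicator A \<omega> * (U i \<omega>)\<^sup>2 \<partial>M) \<le> (\<Sum>i\<in>{1..t}. B\<^sup>2 * prob A)"
    by (rule sum_mono)
  then have "(\<integral>\<omega>. indicator A \<omega> * (\<Sum>\<tau>\<in>{1..t}. U (J t \<tau> \<omega>) \<omega>)\<^sup>2 \<partial>M) / real t \<le> B\<^sup>2 * prob A"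
    using moment_eq t by (simp add: divide_simps mult_ac)
  then show "(\<integral>\<omega>. indicator A \<omega> * (real t * (boot_mean t \<omega> - data_mean t \<omega>)\<^sup>2) \<partial>M) \<le> B\<^sup>2 * prob A"
    unfolding dev times_divide_eq_right by (simp only: integral_divide_zero)
qed

text \<open>
  Chebyshev's inequality in pointwise form.  Below the kink the sample multiplier equals \<open>1\<close>, so
  the bootstrap error vanishes unless the resampled mean exceeds \<open>1\<close>; in that case the left side
  is at most \<open>-1\<close>, which is a lower bound of the test function.
\<close>

lemma clipped_neg_boot_error_ge:
  assumes K: "0 < K" and \<omega>: "\<omega> \<in> low_mean K t"
  shows "- (real t * (boot_mean t \<omega> - data_mean t \<omega>)\<^sup>2 / K\<^sup>2)
    \<le> clipped_neg (sqrt (real t) * (1 / max 1 (boot_mean t \<omega>) - 1 / max 1 (data_mean t \<omega>)))"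
    (is "_ \<le> clipped_neg ?X")
proof -
  have gap: "K \<le> sqrt (real t) * (1 - data_mean t \<omega>)" using \<omega> by (simp add: low_mean_def)
  then have "0 < sqrt (real t) * (1 - data_mean t \<omega>)" using K by linarith
  then have "data_mean t \<omega> < 1" by (simp add: zero_less_mult_iff)
  then have X_eq: "?X = sqrt (real t) * (1 / max 1 (boot_mean t \<omega>) - 1)" by simp
  show ?thesis
  proof (cases "boot_mean t \<omega> \<le> 1")
    case True
    then have "clipped_neg ?X = 0" by (simp add: X_eq clipped_neg_def)
    then show ?thesis by simp
  next
    case False
    then have "sqrt (real t) * (1 - data_mean t \<omega>) \<le> sqrt (real t) * (boot_mean t \<omega> - data_mean t \<omega>)"
      by (intro mult_left_mono) auto
    then have "K\<^sup>2 \<le> (sqrt (real t) * (boot_mean t \<omega> - data_mean t \<omega>))\<^sup>2"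
      using gap K by (intro power_mono) auto
    then have "1 \<le> real t * (boot_mean t \<omega> - data_mean t \<omega>)\<^sup>2 / K\<^sup>2"
      using K by (simp add: power_mult_distrib)
    then show ?thesis using clipped_neg_bounds(1)[of ?X] by linarith
  qed
qed

lemma expectation_clipped_neg_boot_error_ge:
  assumes K: "0 < K" and t: "0 < t"
  shows "- (B\<^sup>2 / K\<^sup>2) * prob (low_mean K t)
    \<le> (\<integral>\<omega>. indicator (low_mean K t) \<omega> * clipped_neg (sqrt (real t) *
          (1 / max 1 (boot_mean t \<omega>) - 1 / max 1 (data_mean t \<omega>))) \<partial>M)"
    (is "_ \<le> (\<integral>\<omega>. indicator ?A \<omega> * clipped_neg (?X \<omega>) \<partial>M)")
proof -
  let ?D = "\<lambda>\<omega>. real t * (boot_mean t \<omega> - data_mean t \<omega>)\<^sup>2"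
  note var = boot_mean_variance[OF t low_mean_F[of K t]]
  have "- (B\<^sup>2 / K\<^sup>2) * prob ?A = - (B\<^sup>2 * prob ?A / K\<^sup>2)" by simp
  also have "\<dots> \<le> - ((\<integral>\<omega>. indicator ?A \<omega> * ?D \<omega> \<partial>M) / K\<^sup>2)"
    using var(2) by (intro le_imp_neg_le divide_right_mono) auto
  also have "\<dots> = (\<integral>\<omega>. - (indicator ?A \<omega> * ?D \<omega> / K\<^sup>2) \<partial>M)"
    by simp
  also have "\<dots> \<le> (\<integral>\<omega>. indicator ?A \<omega> * clipped_neg (?X \<omega>) \<partial>M)"
  proof (rule integral_mono)
    show "integrable M (\<lambda>\<omega>. - (indicator ?A \<omega> * ?D \<omega> / K\<^sup>2))"
      by (intro integrable_minus integrable_divide var(1))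
    show "integrable M (\<lambda>\<omega>. indicator ?A \<omega> * clipped_neg (?X \<omega>))"
    proof (rule integrable_const_bound[where B = 1])
      show "AE \<omega> in M. norm (indicator ?A \<omega> * clipped_neg (?X \<omega>)) \<le> 1"
        using clipped_neg_bounds(1) by (intro AE_I2) (simp add: indicator_def)
    qed measurable
    show "- (indicator ?A \<omega> * ?D \<omega> / K\<^sup>2) \<le> indicator ?A \<omega> * clipped_neg (?X \<omega>)" for \<omega>
      using clipped_neg_boot_error_ge[OF K, of \<omega> t] by (cases "\<omega> \<in> ?A") auto
  qed
  finally show ?thesis .
qed

text \<open>
  On the event \<open>low_mean K t\<close> consistency forces the integral of the test function towards
  \<open>- d p\<close>, with \<open>p\<close> the limit probability of the event, whereas Chebyshev keeps it above
  \<open>- (d / 2) p\<close> asymptotically.  Weak convergence transfers the value \<open>d\<close> from the censored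
  normal law to any limit law \<open>L\<close>.
\<close>

theorem bootstrap_inconsistent:
  assumes L: "real_distribution L"
    and conv: "weak_conv_m (\<lambda>t. distr M borel (\<lambda>\<omega>. sqrt (real t) * (1 / max 1 (data_mean t \<omega>) - 1))) L"
    and X: "\<And>t \<omega>. \<omega> \<in> space M \<Longrightarrow>
      X t \<omega> = sqrt (real t) * (1 / max 1 (boot_mean t \<omega>) - 1 / max 1 (data_mean t \<omega>))"
  shows "\<not> consistently_estimates M F X L"
proof
  assume cons: "consistently_estimates M F X L"
  define d where "d = - (\<integral>x. clipped_neg x \<partial>L)"
  have "norm (clipped_neg x) \<le> 1" for x using clipped_neg_bounds(1) by simp
  then have "(\<integral>x. clipped_neg x \<partial>L) = (\<integral>x. clipped_neg x \<partial>censored_normal \<sigma>)"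
    by (intro LIMSEQ_unique[OF
          weak_conv_imp_integral_bdd_continuous_conv[OF real_distribution_rescaled_multiplier
            L conv isCont_clipped_neg]
          weak_conv_imp_integral_bdd_continuous_conv[OF real_distribution_rescaled_multiplier
            real_distribution_censored_normal rescaled_multiplier_weak_conv isCont_clipped_neg]])
  then have d_pos: "0 < d"
    using integral_clipped_neg_censored_normal[OF \<sigma>_pos] by (simp add: d_def)
  \<comment> \<open>chosen so that Chebyshev's bound \<open>B\<^sup>2 / K\<^sup>2\<close> is half of what consistency requires\<close>
  define K where "K = B * sqrt (2 / d)"
  have K: "0 < K" "B\<^sup>2 / K\<^sup>2 = d / 2"
    using B_pos d_pos by (auto simp: K_def power_mult_distrib)
  define p where "p = measure std_normal_distribution {..- K / \<sigma>}"
  define Ef where "Ef = (\<lambda>t. \<integral>\<omega>. indicator (low_mean K t) \<omega> * clipped_neg (X t \<omega>) \<partial>M)"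
  have X_meas: "X t \<in> borel_measurable M" for t
  proof -
    have "(\<lambda>\<omega>. sqrt (real t) * (1 / max 1 (boot_mean t \<omega>) - 1 / max 1 (data_mean t \<omega>)))
        \<in> borel_measurable M" by measurable
    then show ?thesis by (rule measurable_cong[THEN iffD1, rotated]) (simp add: X)
  qed
  have lim: "(\<lambda>t. Ef t + d * prob (low_mean K t)) \<longlonglongrightarrow> 0"
    using consistently_estimates_on_data_events[OF cons L F_sub X_meas clipped_neg_BL1 low_mean_F[of K]]
    by (simp add: Ef_def d_def mult.commute)
  have "(\<lambda>t. d / 2 * prob (low_mean K t)) \<longlonglongrightarrow> d / 2 * p"
    unfolding p_def by (intro tendsto_mult tendsto_const prob_low_mean_tendsto)
  then have "d / 2 * p \<le> 0"
  proof (rule tendsto_le[OF sequentially_bot lim])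
    show "\<forall>\<^sub>F t in sequentially. d / 2 * prob (low_mean K t) \<le> Ef t + d * prob (low_mean K t)"
      using eventually_gt_at_top[of 0]
    proof eventually_elim
      case (elim t)
      have "Ef t = (\<integral>\<omega>. indicator (low_mean K t) \<omega> * clipped_neg (sqrt (real t) *
          (1 / max 1 (boot_mean t \<omega>) - 1 / max 1 (data_mean t \<omega>))) \<partial>M)"
        unfolding Ef_def by (intro Bochner_Integration.integral_cong) (simp_all add: X)
      then have "- (d / 2) * prob (low_mean K t) \<le> Ef t"
        using expectation_clipped_neg_boot_error_ge[OF K(1) elim] unfolding K(2) by simp
      then show ?case by (simp add: field_simps)
    qed
  qed
  moreover have "0 < p" unfolding p_def by (rule prob_low_mean_tendsto(2))
  ultimately show False using mult_pos_pos[of "d / 2" p] d_pos by linarith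
qed

end

section \<open>The one-buyer first-price pacing equilibrium\<close>

text \<open>
  It remains to recognise the market as an instance of the setting above.  The valuations
  inherit independence from the items, and their moments are the supply means because the items
  have density \<open>s\<close>.
\<close>

theorem theorem2:
  fixes \<Theta> :: "'a measure" and s v1 :: "'a \<Rightarrow> real" and b1 :: real
    and M :: "'w measure" and \<theta> :: "nat \<Rightarrow> 'w \<Rightarrow> 'a" and J :: "nat \<Rightarrow> nat \<Rightarrow> 'w \<Rightarrow> nat"
    and \<beta>_star :: real and \<beta>_gamma \<beta>_boot :: "nat \<Rightarrow> 'w \<Rightarrow> real"
  assumes s_nonneg: "\<And>x. x \<in> space \<Theta> \<Longrightarrow> 0 \<le> s x"
    and s_bounded: "\<exists>B. \<forall>x\<in>space \<Theta>. s x \<le> B"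
    and s_integrable: "integrable \<Theta> s"
    and s_total: "(\<integral>x. s x \<partial>\<Theta>) = 1"
    and v_nonneg: "\<And>x. x \<in> space \<Theta> \<Longrightarrow> 0 \<le> v1 x"
    and v_bounded: "\<exists>B. \<forall>x\<in>space \<Theta>. v1 x \<le> B"
    and v_integrable: "integrable \<Theta> v1"
    and v_mean: "supply_mean \<Theta> s v1 = 1"
    and v_nondegenerate: "supply_mean \<Theta> s (\<lambda>x. (v1 x - supply_mean \<Theta> s v1)\<^sup>2) > 0"
    and budget: "b1 = 1"
    and M: "prob_space M"
    and draws: "iid_draws M \<Theta> s \<theta>"
    and boot: "multinomial_bootstrap M \<Theta> \<theta> J"
  defines "\<beta>_star \<equiv> pacing_multiplier b1 (supply_mean \<Theta> s v1)"
    and "\<beta>_gamma \<equiv> (\<lambda>t \<omega>. pacing_multiplier b1 (sample_mean (\<lambda>\<tau>. v1 (\<theta> \<tau> \<omega>)) t))"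
    and "\<beta>_boot \<equiv> (\<lambda>t \<omega>. pacing_multiplier b1 (sample_mean (\<lambda>\<tau>. v1 (resample \<theta> J t \<tau> \<omega>)) t))"
  shows "(\<exists>L. real_distribution L \<and>
            weak_conv_m (\<lambda>t. distr M borel (\<lambda>\<omega>. sqrt (real t) * (\<beta>_gamma t \<omega> - \<beta>_star))) L) \<and>
         (\<forall>L. real_distribution L \<and>
            weak_conv_m (\<lambda>t. distr M borel (\<lambda>\<omega>. sqrt (real t) * (\<beta>_gamma t \<omega> - \<beta>_star))) L \<longrightarrow>
            \<not> consistently_estimates M (data_algebra M \<Theta> \<theta>)
                (\<lambda>t \<omega>. sqrt (real t) * (\<beta>_boot t \<omega> - \<beta>_gamma t \<omega>)) L)"
proof -
  interpret prob_space M by fact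
  obtain B0 where B0: "\<And>x. x \<in> space \<Theta> \<Longrightarrow> v1 x \<le> B0" using v_bounded by blast
  \<comment> \<open>the maximum only serves to make the bound positive\<close>
  define B where "B = max 1 B0"
  have B: "0 < B" "\<And>x. x \<in> space \<Theta> \<Longrightarrow> v1 x \<le> B"
    using B0 by (auto simp: B_def le_max_iff_disj)
  have v_meas[measurable]: "v1 \<in> borel_measurable \<Theta>" and s_meas[measurable]: "s \<in> borel_measurable \<Theta>"
    using v_integrable s_integrable by auto
  have \<theta>_meas: "\<theta> \<tau> \<in> M \<rightarrow>\<^sub>M \<Theta>" if "1 \<le> \<tau>" for \<tau>
    using draws that unfolding iid_draws_def distributed_def by blast
  have \<theta>_distr: "distr M \<Theta> (\<theta> \<tau>) = density \<Theta> (\<lambda>x. ennreal (s x))" if "1 \<le> \<tau>" for \<tau>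
    using draws that unfolding iid_draws_def distributed_def by blast
  define V where "V = (\<lambda>\<tau> \<omega>. v1 (\<theta> \<tau> \<omega>))"
  have E_draw: "expectation (\<lambda>\<omega>. g (\<theta> \<tau> \<omega>)) = supply_mean \<Theta> s g"
    if "1 \<le> \<tau>" "g \<in> borel_measurable \<Theta>" for g \<tau>
  proof -
    have "expectation (\<lambda>\<omega>. g (\<theta> \<tau> \<omega>)) = integral\<^sup>L (distr M \<Theta> (\<theta> \<tau>)) g"
      using \<theta>_meas[OF that(1)] that(2) by (subst integral_distr) auto
    also have "\<dots> = (\<integral>x. s x *\<^sub>R g x \<partial>\<Theta>)"
      unfolding \<theta>_distr[OF that(1)] using s_nonneg that(2) by (intro integral_density) auto
    finally show ?thesis by (simp add: supply_mean_def mult.commute)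
  qed
  define \<sigma> where "\<sigma> = sqrt (supply_mean \<Theta> s (\<lambda>x. (v1 x - 1)\<^sup>2))"
  have \<sigma>: "0 < \<sigma>" "\<sigma>\<^sup>2 = supply_mean \<Theta> s (\<lambda>x. (v1 x - 1)\<^sup>2)"
    using v_nondegenerate v_mean by (auto simp: \<sigma>_def)
  have V_mean: "expectation (V \<tau>) = 1" if "1 \<le> \<tau>" for \<tau>
    using E_draw[OF that v_meas] v_mean by (simp add: V_def)
  let ?F = "data_algebra M \<Theta> \<theta>"
  interpret resampled_draws M V ?F J B \<sigma>
  proof
    show "0 \<le> V \<tau> \<omega> \<and> V \<tau> \<omega> \<le> B" if "1 \<le> \<tau>" "\<omega> \<in> space M" for \<tau> \<omega>
      using measurable_space[OF \<theta>_meas[OF that(1)] that(2)] B(2) v_nonneg by (auto simp: V_def)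
    show "0 < B" by (rule B(1))
    \<comment> \<open>the shift from \<open>{1..}\<close> to \<open>UNIV\<close> goes through restrictions to singleton blocks\<close>
    have "indep_vars (\<lambda>_. \<Theta>) \<theta> {1..}" using draws by (simp add: iid_draws_def)
    then have "indep_vars (\<lambda>i. \<Pi>\<^sub>M j\<in>{Suc i}. \<Theta>) (\<lambda>i \<omega>. \<lambda>j\<in>{Suc i}. \<theta> j \<omega>) UNIV"
      by (rule indep_vars_restrict) (auto simp: disjoint_family_on_def)
    then have "indep_vars (\<lambda>_. borel) (\<lambda>i \<omega>. v1 ((\<lambda>j\<in>{Suc i}. \<theta> j \<omega>) (Suc i))) UNIV"
      by (rule indep_vars_compose2[where Y = "\<lambda>i f. v1 (f (Suc i))"])
        (rule measurable_compose[OF _ v_meas], rule measurable_component_singleton, simp)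
    then show "indep_vars (\<lambda>_. borel) (\<lambda>i. V (Suc i)) UNIV" by (simp add: V_def)
    have "distr M borel (V \<tau>) = distr (density \<Theta> (\<lambda>x. ennreal (s x))) borel v1" if "1 \<le> \<tau>" for \<tau>
      unfolding \<theta>_distr[OF that, symmetric]
      using \<theta>_meas[OF that] by (subst distr_distr) (auto simp: V_def comp_def)
    then show "distr M borel (V \<tau>) = distr M borel (V 1)" if "1 \<le> \<tau>" for \<tau>
      using that by simp
    show "expectation (V \<tau>) = 1" if "1 \<le> \<tau>" for \<tau> by (rule V_mean[OF that])
    show "variance (V \<tau>) = \<sigma>\<^sup>2" if "1 \<le> \<tau>" for \<tau>
      unfolding V_mean[OF that] \<sigma>(2) using E_draw[OF that, of "\<lambda>x. (v1 x - 1)\<^sup>2"]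
      by (simp add: V_def)
    show "0 < \<sigma>" by (rule \<sigma>(1))
    show "subalgebra M (?F t)" for t
      by (rule subalgebra_data_algebra) (simp add: \<theta>_meas)
    show "V i \<in> borel_measurable (?F t)" if "i \<in> {1..t}" for i t
      unfolding V_def
      by (rule measurable_compose[OF measurable_data_algebra v_meas]) (use that \<theta>_meas in auto)
    show "indep_vars (\<lambda>_. count_space {1..t}) (J t) {1..t}"
      and "indep_set (sets (?F t)) (sets (data_algebra M (count_space {1..t}) (J t) t))" if "0 < t" for t
      using boot that unfolding multinomial_bootstrap_def by simp_all
    show "distr M (count_space {1..t}) (J t \<tau>) = uniform_count_measure {1..t}" if "\<tau> \<in> {1..t}" for t \<tau>
    proof -
      have "1 \<le> t" using that by simp
      then show ?thesis using boot that unfolding multinomial_bootstrap_def by blast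
    qed
  qed
  have star: "\<beta>_star = 1"
    unfolding \<beta>_star_def budget v_mean by (simp add: pacing_multiplier_one)
  have gamma: "\<beta>_gamma t \<omega> = 1 / max 1 (data_mean t \<omega>)" if "\<omega> \<in> space M" for t \<omega>
  proof -
    have "data_mean t \<omega> = sample_mean (\<lambda>\<tau>. v1 (\<theta> \<tau> \<omega>)) t"
      unfolding data_mean_def unfolding V_def ..
    then show ?thesis
      using pacing_multiplier_one[OF data_mean_nonneg[OF that, of t]] unfolding \<beta>_gamma_def budget by simp
  qed
  have boot_eq: "\<beta>_boot t \<omega> = 1 / max 1 (boot_mean t \<omega>)" if "\<omega> \<in> space M" for t \<omega>
  proof -
    have "boot_mean t \<omega> = sample_mean (\<lambda>\<tau>. v1 (resample \<theta> J t \<tau> \<omega>)) t"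
      unfolding boot_mean_def unfolding V_def resample_def ..
    then show ?thesis
      using pacing_multiplier_one[OF boot_mean_nonneg[OF that, of t]] unfolding \<beta>_boot_def budget by simp
  qed
  have err: "distr M borel (\<lambda>\<omega>. sqrt (real t) * (\<beta>_gamma t \<omega> - \<beta>_star))
      = distr M borel (\<lambda>\<omega>. sqrt (real t) * (1 / max 1 (data_mean t \<omega>) - 1))" for t
    by (intro distr_cong refl) (simp add: gamma star)
  have "\<not> consistently_estimates M ?F (\<lambda>t \<omega>. sqrt (real t) * (\<beta>_boot t \<omega> - \<beta>_gamma t \<omega>)) L"
    if "real_distribution L" "weak_conv_m (\<lambda>t. distr M borel
      (\<lambda>\<omega>. sqrt (real t) * (1 / max 1 (data_mean t \<omega>) - 1))) L" for L
    using that by (rule bootstrap_inconsistent) (simp only: gamma boot_eq)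
  then show ?thesis
    unfolding err using real_distribution_censored_normal rescaled_multiplier_weak_conv by blast
qed

end
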